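(* Let $H(x,y)=\sum_{n\ge1}\sum_{\sigma\in S_n(T_1)}x^ny^{\sigma(1)}$. Then $$H(x,y)=\frac{xy\left[(xy-1)^2(1-y)\sqrt{1-4x}+x(1-2xy)\right]}{(1-y+xy^2)(1-2xy)\sqrt{1-4x}}.$$
   Context: A permutation $\sigma$ avoids $\tau$ if no subsequence of $\sigma$ has the same relative order as $\tau$. $T_1=\{3214,3241,4213,4231\}$ and $S_n(T_1)$ is the set of permutations in $S_n$ avoiding all four patterns. *)

theory Defs
  imports
    Complex_Main
    "HOL-Library.Sublist"
    "HOL-Combinatorics.Multiset_Permutations"
    "HOL-Computational_Algebra.Formal_Power_Series"
begin

definition same_relative_order :: "'a::linorder list \<Rightarrow> 'b::linorder list \<Rightarrow> bool" where
  "same_relative_order xs ys \<longleftrightarrow>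
     length xs = length ys \<and>
     (\<forall>i < length xs. \<forall>j < length xs. xs ! i < xs ! j \<longleftrightarrow> ys ! i < ys ! j)"

text \<open>Permutations and patterns are written in one-line notation.\<close>

definition avoids :: "nat list \<Rightarrow> nat list \<Rightarrow> bool" where
  "avoids \<sigma> \<tau> \<longleftrightarrow> \<not> (\<exists>\<rho>. subseq \<rho> \<sigma> \<and> same_relative_order \<rho> \<tau>)"

definition avoiders :: "nat \<Rightarrow> nat list set \<Rightarrow> nat list set" where
  "avoiders n T = {\<sigma> \<in> permutations_of_set {1..n}. \<forall>\<tau> \<in> T. avoids \<sigma> \<tau>}"

definition T1 :: "nat list set" where
  "T1 = {[3,2,1,4], [3,2,4,1], [4,2,1,3], [4,2,3,1]}"

text \<open>
  Bivariate series live in \<open>\<real>[[y]][[x]]\<close>: the outer indeterminate is \<open>x\<close> and the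
  coefficients are power series in \<open>y\<close>.  In this ring \<open>1 - y + x y\<^sup>2\<close> is a unit,
  since its constant coefficient \<open>1 - y\<close> is a unit of \<open>\<real>[[y]]\<close>.
\<close>

definition var_x :: "real fps fps" where
  "var_x = fps_X"

definition var_y :: "real fps fps" where
  "var_y = fps_const fps_X"

definition of_series_x :: "real fps \<Rightarrow> real fps fps" where
  "of_series_x f = Abs_fps (\<lambda>n. fps_const (fps_nth f n))"

text \<open>The square root is the one with constant coefficient \<open>root 2 1 = 1\<close>.\<close>

definition sqrt_1_minus_4x :: "real fps fps" where
  "sqrt_1_minus_4x = of_series_x (fps_radical root 2 (1 - 4 * fps_X))"

definition H :: "real fps fps" where
  "H = Abs_fps (\<lambda>n. if n = 0 then 0 else (\<Sum>\<sigma> \<in> avoiders n T1. fps_X ^ hd \<sigma>))"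

end

theory Submission
  imports Defs
begin

text \<open>
  The four patterns say that some entry \<open>b\<close> has a larger entry to its left and both a smaller and a
  larger entry to its right.  So \<open>\<sigma>\<close> avoids them iff every entry is a left-to-right maximum, or lies
  below all later entries, or above all later entries.  Reading \<open>\<sigma>\<close> from left to right, the number
  \<open>F(a, b)\<close> (\<open>completions a b\<close>) of ways to finish depends only on the numbers \<open>a\<close> and \<open>b\<close> of remaining values below and
  above the current maximum.  Choosing the next value gives, for \<open>b \<ge> 1\<close>,
  \<open>F(a, b) = [a \<ge> 1] F(a - 1, b) + (\<Sum>i<b. F(a + i, b - 1 - i))\<close>; subtracting neighbouring instances
  turns this into \<open>F(a, b) = F(a - 1, b) + F(a + 1, b - 1)\<close> for \<open>b \<ge> 2\<close>, which Pascal's rule solves in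
  closed form, with \<open>F(0, b) = (2b - 2 choose b - 1)\<close>.  The permutations of size \<open>n\<close> starting with \<open>k\<close>
  number \<open>F(k - 1, n - k)\<close>, so the recurrence cancels almost every coefficient of
  \<open>(1 - y + x y\<^sup>2) H\<close>.  What remains is
  \<open>x y (1 - y) + x\<^sup>2 y / sqrt (1 - 4 x) + (1 - y) x\<^sup>3 y\<^sup>3 / (1 - 2 x y)\<close>.
\<close>

unbundle fps_syntax

subsection \<open>Avoidance read from left to right\<close>

definition straddles :: "nat set \<Rightarrow> nat \<Rightarrow> bool" where
  "straddles A x \<longleftrightarrow> (\<exists>c\<in>A. c < x) \<and> (\<exists>d\<in>A. x < d)"

text \<open>Here \<open>m\<close> stands for the largest entry already read, the best candidate for
  the first entry of a pattern whose other three entries lie in \<open>xs\<close>.\<close>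

definition has_pattern_below :: "nat \<Rightarrow> nat list \<Rightarrow> bool" where
  "has_pattern_below m xs \<longleftrightarrow> (\<exists>b c d. subseq [b, c, d] xs \<and> b < m \<and> (c < b \<and> b < d \<or> d < b \<and> b < c))"

definition has_pattern :: "nat list \<Rightarrow> bool" where
  "has_pattern xs \<longleftrightarrow> (\<exists>a b c d. subseq [a, b, c, d] xs \<and> b < a \<and> (c < b \<and> b < d \<or> d < b \<and> b < c))"

definition admissible :: "nat \<Rightarrow> nat list \<Rightarrow> bool" where
  "admissible m xs \<longleftrightarrow> \<not> has_pattern_below m xs \<and> \<not> has_pattern xs"

lemma subseq_pair:
  assumes "c \<in> set xs" "d \<in> set xs" "c \<noteq> d"
  shows "subseq [c, d] xs \<or> subseq [d, c] xs"
  using assms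
proof (induction xs)
  case (Cons x xs)
  then show ?case
    by (auto simp: subseq_Cons2_iff subseq_singleton_left)
qed simp

lemma subseq_Cons_Cons_iff:
  "subseq (a # as) (x # xs) \<longleftrightarrow> a = x \<and> subseq as xs \<or> subseq (a # as) xs"
  by (auto dest: subseq_Cons')

lemma has_pattern_Cons: "has_pattern (x # xs) \<longleftrightarrow> has_pattern_below x xs \<or> has_pattern xs"
proof -
  have "has_pattern (x # xs) \<longleftrightarrow> (\<exists>a b c d. a = x \<and> subseq [b, c, d] xs \<and> b < a \<and>
      (c < b \<and> b < d \<or> d < b \<and> b < c)) \<or> has_pattern xs"
    unfolding has_pattern_def subseq_Cons_Cons_iff conj_disj_distribR ex_disj_distrib conj_assoc ..
  then show ?thesis
    unfolding has_pattern_below_def by simp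
qed

text \<open>Both orders of the outer pair are forbidden, so only the set of later entries matters,
  not their arrangement. This lets the count below work with sets of remaining values.\<close>

lemma straddles_iff_subseq:
  "straddles (set xs) b \<longleftrightarrow>
     (\<exists>c d. subseq [c, d] xs \<and> (c < b \<and> b < d \<or> d < b \<and> b < c))"
proof
  assume "straddles (set xs) b"
  then obtain c d where cd: "c \<in> set xs" "d \<in> set xs" "c < b" "b < d"
    unfolding straddles_def by blast
  then have "subseq [c, d] xs \<or> subseq [d, c] xs"
    by (intro subseq_pair) auto
  with cd show "\<exists>c d. subseq [c, d] xs \<and> (c < b \<and> b < d \<or> d < b \<and> b < c)"
    by blast
next
  assume "\<exists>c d. subseq [c, d] xs \<and> (c < b \<and> b < d \<or> d < b \<and> b < c)"
  then obtain c d where "subseq [c, d] xs" and *: "c < b \<and> b < d \<or> d < b \<and> b < c" by blast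
  then have "set [c, d] \<subseteq> set xs"
    by (metis subseq_conv_nths set_nths_subset)
  then have "c \<in> set xs" "d \<in> set xs"
    by simp_all
  with * show "straddles (set xs) b"
    unfolding straddles_def by blast
qed

lemma has_pattern_below_Cons:
  "has_pattern_below m (x # xs) \<longleftrightarrow> x < m \<and> straddles (set xs) x \<or> has_pattern_below m xs"
proof -
  have "has_pattern_below m (x # xs) \<longleftrightarrow> (\<exists>b c d. b = x \<and> subseq [c, d] xs \<and> b < m \<and>
      (c < b \<and> b < d \<or> d < b \<and> b < c)) \<or> has_pattern_below m xs"
    unfolding has_pattern_below_def subseq_Cons_Cons_iff conj_disj_distribR ex_disj_distrib conj_assoc ..
  then show ?thesis
    unfolding straddles_iff_subseq by simp metis
qed

lemma admissible_Nil: "admissible m []"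
  by (simp add: admissible_def has_pattern_below_def has_pattern_def)

text \<open>Some entry already read exceeds \<open>b\<close> iff the largest one does, so the prefix
  can be forgotten except for its maximum.\<close>

lemma admissible_Cons:
  "admissible m (x # xs) \<longleftrightarrow>
     (m \<le> x \<or> \<not> straddles (set xs) x) \<and> admissible (max m x) xs"
proof -
  have "has_pattern_below (max m x) xs \<longleftrightarrow> has_pattern_below m xs \<or> has_pattern_below x xs"
    unfolding has_pattern_below_def less_max_iff_disj
    by (simp add: conj_disj_distribL conj_disj_distribR ex_disj_distrib disj_ac)
  then show ?thesis
    unfolding admissible_def has_pattern_below_Cons has_pattern_Cons by auto
qed

text \<open>In each pattern of \<open>T1\<close> the second entry is below the first and lies in
  value between the last two. The four patterns are the two orders of the last two, times the two
  ways their larger one compares with the first.\<close>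

lemma avoids_T1_iff:
  assumes "distinct \<sigma>"
  shows "(\<forall>\<tau>\<in>T1. avoids \<sigma> \<tau>) \<longleftrightarrow> \<not> has_pattern \<sigma>"
proof -
  have sro: "same_relative_order [a, b, c, d] [p, q, r, t] \<longleftrightarrow>
      (\<forall>(u,v)\<in>{(a,p),(b,q),(c,r),(d,t)}. \<forall>(u',v')\<in>{(a,p),(b,q),(c,r),(d,t)}. u < u' \<longleftrightarrow> v < v')"
    for a b c d p q r t :: nat
    by (simp add: same_relative_order_def numeral_eq_Suc All_less_Suc2)
  have len: "\<exists>a b c d. \<rho> = [a, b, c, d]" if "\<tau> \<in> T1" "same_relative_order \<rho> \<tau>"
    for \<rho> \<tau> :: "nat list"
  proof -
    have "length \<rho> = 4"
      using that by (auto simp: T1_def same_relative_order_def)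
    then show ?thesis
      by (auto simp: numeral_eq_Suc length_Suc_conv)
  qed
  have "(\<exists>\<tau>\<in>T1. same_relative_order [a, b, c, d] \<tau>) \<longleftrightarrow>
      b < a \<and> (c < b \<and> b < d \<or> d < b \<and> b < c)" if "subseq [a, b, c, d] \<sigma>" for a b c d
  proof -
    have "distinct [a, b, c, d]"
      using that assms by (metis subseq_conv_nths distinct_nthsI)
    moreover have "same_relative_order [a, b, c, d] [3 :: nat, 2, 1, 4] \<longleftrightarrow> c < b \<and> b < a \<and> a < d"
      by (simp add: sro) linarith
    moreover have "same_relative_order [a, b, c, d] [3 :: nat, 2, 4, 1] \<longleftrightarrow> d < b \<and> b < a \<and> a < c"
      by (simp add: sro) linarith
    moreover have "same_relative_order [a, b, c, d] [4 :: nat, 2, 1, 3] \<longleftrightarrow> c < b \<and> b < d \<and> d < a"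
      by (simp add: sro) linarith
    moreover have "same_relative_order [a, b, c, d] [4 :: nat, 2, 3, 1] \<longleftrightarrow> d < b \<and> b < c \<and> c < a"
      by (simp add: sro) linarith
    ultimately show ?thesis
      using linorder_neqE_nat[of a c] linorder_neqE_nat[of a d] unfolding T1_def
      by (simp only: bex_simps distinct.simps list.set insert_iff) (metis less_trans)
  qed
  then have eq: "(\<exists>\<tau>\<in>T1. same_relative_order \<rho> \<tau>) \<longleftrightarrow>
      (\<exists>a b c d. \<rho> = [a, b, c, d] \<and> b < a \<and> (c < b \<and> b < d \<or> d < b \<and> b < c))"
    if "subseq \<rho> \<sigma>" for \<rho>
    using that len by metis
  show ?thesis
    unfolding avoids_def has_pattern_def using eq by blast
qed

subsection \<open>The number of completions\<close>

text \<open>Ranks in \<open>U\<close> run through 0, ..., \<open>card U - 1\<close>: a new maximum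
  \<open>b\<close> has rank \<open>card A\<close> and changes no other rank.\<close>

lemma sum_card_below:
  fixes g :: "nat \<Rightarrow> real" and U :: "nat set"
  assumes "finite U"
  shows "(\<Sum>x\<in>U. g (card {y\<in>U. y < x})) = (\<Sum>i<card U. g i)"
  using assms
proof (induction rule: finite_linorder_max_induct)
  case (insert b A)
  have "b \<notin> A" using insert by auto
  have "{y \<in> insert b A. y < b} = A" using insert by auto
  moreover have "{y \<in> insert b A. y < x} = {y \<in> A. y < x}" if "x \<in> A" for x
    using insert that by auto
  ultimately have "(\<Sum>x\<in>insert b A. g (card {y\<in>insert b A. y < x})) =
      g (card A) + (\<Sum>x\<in>A. g (card {y\<in>A. y < x}))"
    using insert \<open>b \<notin> A\<close> by (simp cong: sum.cong)
  then show ?case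
    using insert \<open>b \<notin> A\<close> by simp
qed simp

text \<open>The second clause removes two equal tails from a full row: it is the sum of the
  binomials (\<open>a + 2 * b\<close> choose \<open>i\<close>) for \<open>i\<close> from
  \<open>b\<close> to \<open>a + b\<close>. In the first clause nothing is left above the maximum,
  so each entry must be the least or the greatest of those left.\<close>

fun completions :: "nat \<Rightarrow> nat \<Rightarrow> real" where
  "completions a 0 = (if a = 0 then 1 else 2 ^ (a - 1))"
| "completions a (Suc b) = 2 ^ (a + 2 * b) - 2 * (\<Sum>i<b. real ((a + 2 * b) choose i))"

text \<open>Pascal's rule summed over an initial segment; the shift in one summand shortens its
  range by one.\<close>

lemma sum_choose_Suc:
  "(\<Sum>i<Suc j. real (Suc m choose i)) = (\<Sum>i<Suc j. real (m choose i)) + (\<Sum>i<j. real (m choose i))"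
  by (induction j) simp_all

text \<open>An odd row has no middle entry, so by symmetry its lower half carries half of the
  total.\<close>

lemma sum_choose_half: "2 * (\<Sum>i<Suc b. real ((2 * b + 1) choose i)) = 2 ^ (2 * b + 1)"
proof -
  have "real (\<Sum>k\<le>b. (2 * b + 1) choose k) = 2 ^ (2 * b)"
    unfolding binomial_r_part_sum by simp
  then show ?thesis
    by (simp add: lessThan_Suc_atMost)
qed

text \<open>Both terms on the right use row \<open>a + 2 * b + 2\<close>, with cutoffs
  \<open>Suc b\<close> and \<open>b\<close>; the left side uses the next row, so this is Pascal's
  rule for partial rows.\<close>

lemma completions_Suc_Suc:
  "completions (Suc a) (Suc (Suc b)) = completions a (Suc (Suc b)) + completions (Suc (Suc a)) (Suc b)"
proof -
  have "(\<Sum>i<Suc b. real (Suc (a + 2 * b + 2) choose i)) =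
    (\<Sum>i<Suc b. real ((a + 2 * b + 2) choose i)) + (\<Sum>i<b. real ((a + 2 * b + 2) choose i))"
    by (rule sum_choose_Suc)
  then show ?thesis
    by (simp add: algebra_simps)
qed

text \<open>The boundary case of the same recurrence: the absent term, the closed form continued to
  first argument -1, is zero by \<open>sum_choose_half\<close>.\<close>

lemma completions_0_Suc_Suc: "completions 0 (Suc (Suc b)) = completions (Suc 0) (Suc b)"
proof -
  have "(\<Sum>i<Suc b. real (Suc (2 * b + 1) choose i)) =
    (\<Sum>i<Suc b. real ((2 * b + 1) choose i)) + (\<Sum>i<b. real ((2 * b + 1) choose i))"
    by (rule sum_choose_Suc)
  then show ?thesis
    using sum_choose_half[of b] by (simp add: algebra_simps)
qed

text \<open>The recurrence telescopes: peeling off the first term leaves the same sum started at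
  \<open>Suc a\<close>, whose subtracted term cancels what was peeled.\<close>

lemma completions_diagonal_sum:
  "(\<Sum>i<Suc b. completions (a + i) (b - i)) =
     completions a (Suc b) - (if a = 0 then 0 else completions (a - 1) (Suc b))"
proof (induction b arbitrary: a)
  case 0
  then show ?case by (cases a) simp_all
next
  case (Suc b)
  have "(\<Sum>i<Suc (Suc b). completions (a + i) (Suc b - i)) =
      completions a (Suc b) + (\<Sum>i<Suc b. completions (Suc a + i) (b - i))"
    by (subst sum.lessThan_Suc_shift) simp
  also have "\<dots> = completions (Suc a) (Suc b)"
    unfolding Suc.IH by simp
  also have "\<dots> = completions a (Suc (Suc b)) - (if a = 0 then 0 else completions (a - 1) (Suc (Suc b)))"
    by (cases a) (simp_all only: completions_Suc_Suc completions_0_Suc_Suc, simp_all)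
  finally show ?case .
qed

text \<open>Removing both tails from row \<open>2 * b\<close> leaves just its middle entry.\<close>

lemma completions_0_Suc: "completions 0 (Suc b) = real ((2 * b) choose b)"
proof (cases b)
  case (Suc c)
  have "2 * (\<Sum>i<Suc c. real ((2 * c + 1) choose i)) = 2 ^ (2 * c + 1)"
    by (rule sum_choose_half)
  moreover have "(2 * c + 1) choose c = (2 * c + 1) choose Suc c"
    using binomial_symmetric[of c "2 * c + 1"] by simp
  ultimately show ?thesis
    unfolding Suc completions_0_Suc_Suc by simp
qed simp

section \<open>Counting admissible arrangements of a set by their first entry\<close>

definition num_admissible :: "nat \<Rightarrow> nat set \<Rightarrow> nat" where
  "num_admissible m A = card {xs \<in> permutations_of_set A. admissible m xs}"

lemma num_admissible_nonempty:
  assumes "finite A" "A \<noteq> {}"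
  shows "num_admissible m A =
    (\<Sum>x\<in>A. if m \<le> x \<or> \<not> straddles (A - {x}) x then num_admissible (max m x) (A - {x}) else 0)"
proof -
  define B where "B x = {xs \<in> permutations_of_set (A - {x}). admissible m (x # xs)}" for x
  have "{xs \<in> permutations_of_set A. admissible m xs} = (\<Union>x\<in>A. (#) x ` B x)"
    unfolding permutations_of_set_nonempty[OF assms(2)] B_def by auto
  then have "num_admissible m A = card (\<Union>x\<in>A. (#) x ` B x)"
    by (simp add: num_admissible_def)
  also have "\<dots> = (\<Sum>x\<in>A. card ((#) x ` B x))"
    by (rule card_UN_disjoint) (use assms in \<open>auto simp: B_def\<close>)
  also have "\<dots> = (\<Sum>x\<in>A. card (B x))"
    by (simp add: card_image)
  also have "\<dots> = (\<Sum>x\<in>A. if m \<le> x \<or> \<not> straddles (A - {x}) x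
      then num_admissible (max m x) (A - {x}) else 0)"
  proof (rule sum.cong)
    fix x assume "x \<in> A"
    have "B x = {xs \<in> permutations_of_set (A - {x}).
        (m \<le> x \<or> \<not> straddles (A - {x}) x) \<and> admissible (max m x) xs}"
      unfolding B_def admissible_Cons by (auto dest: permutations_of_setD(1))
    then show "card (B x) = (if m \<le> x \<or> \<not> straddles (A - {x}) x
        then num_admissible (max m x) (A - {x}) else 0)"
      by (simp add: num_admissible_def)
  qed simp
  finally show ?thesis .
qed

text \<open>Only the least and the greatest element are not straddled by the others, and they
  coincide exactly in a singleton.\<close>

lemma card_not_straddled:
  assumes "finite L" "L \<noteq> {}"
  shows "card {x \<in> L. \<not> straddles (L - {x}) x} = (if card L = 1 then 1 else 2)"
proof -
  have "{x \<in> L. \<not> straddles (L - {x}) x} = {Min L, Max L}"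
  proof (intro equalityI subsetI)
    fix x assume "x \<in> {x \<in> L. \<not> straddles (L - {x}) x}"
    then have x: "x \<in> L" and "(\<forall>y\<in>L. x \<le> y) \<or> (\<forall>y\<in>L. y \<le> x)"
      by (auto simp: straddles_def not_less)
    then have "x = Min L \<or> x = Max L"
      using assms Min_eqI[of L x] Max_eqI[of L x] by auto
    then show "x \<in> {Min L, Max L}"
      by simp
  next
    fix x assume "x \<in> {Min L, Max L}"
    moreover have "Min L \<in> L" "Max L \<in> L"
      using assms by simp_all
    ultimately have "x \<in> L" and "(\<forall>y\<in>L. x \<le> y) \<or> (\<forall>y\<in>L. y \<le> x)"
      using assms(1) by auto
    then show "x \<in> {x \<in> L. \<not> straddles (L - {x}) x}"
      by (auto simp: straddles_def not_less dest: leD)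
  qed
  moreover have "Min L = Max L \<longleftrightarrow> card L = 1"
  proof
    assume "Min L = Max L"
    then have "y = Min L" if "y \<in> L" for y
      using that assms(1) by (metis Min_le Max_ge antisym)
    then have "L = {Min L}"
      using assms(2) by blast
    then show "card L = 1"
      by (metis card_1_singleton_iff One_nat_def)
  qed (auto simp: card_1_singleton_iff)
  ultimately show ?thesis
    by (simp add: card_insert_if)
qed

text \<open>Induction on the number of values left, by the next entry \<open>x\<close>. Above
  \<open>m\<close> it is always allowed, and rank \<open>i\<close> among the upper values moves the
  counts to \<open>a + i\<close> and \<open>b - 1 - i\<close>. Below \<open>m\<close> it must not be
  straddled, and the counts become \<open>a - 1\<close> and \<open>b\<close>.\<close>

lemma num_admissible_eq_completions:
  assumes "finite A" "m \<notin> A"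
  shows "real (num_admissible m A) = completions (card {x \<in> A. x < m}) (card {x \<in> A. m < x})"
  using assms
proof (induction "card A" arbitrary: A m rule: less_induct)
  case less
  show ?case
  proof (cases "A = {}")
    case True
    have "{xs \<in> {[]}. admissible m xs} = {[]}"
      by (auto simp: admissible_Nil)
    then show ?thesis
      by (simp add: True num_admissible_def)
  next
    case False
    define L where "L = {x \<in> A. x < m}"
    define U where "U = {x \<in> A. m < x}"
    define a where "a = card L"
    define b where "b = card U"
    have fin: "finite L" "finite U"
      using less.prems by (auto simp: L_def U_def)
    have A: "A = L \<union> U" "L \<inter> U = {}"
      using less.prems by (auto simp: L_def U_def) (metis linorder_neqE_nat)
    have IH: "real (num_admissible (max m x) (A - {x})) =
        completions (card {y \<in> A. y < max m x \<and> y \<noteq> x}) (card {y \<in> A. max m x < y})" if "x \<in> A" for x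
    proof -
      have "card (A - {x}) < card A"
        using that less.prems by (intro psubset_card_mono) auto
      moreover have "max m x \<notin> A - {x}"
        using less.prems by (auto simp: max_def)
      moreover have "{y \<in> A - {x}. y < max m x} = {y \<in> A. y < max m x \<and> y \<noteq> x}"
        "{y \<in> A - {x}. max m x < y} = {y \<in> A. max m x < y}"
        by auto
      ultimately show ?thesis
        using less.hyps[of "A - {x}" "max m x"] less.prems by simp
    qed
    have U: "real (num_admissible (max m x) (A - {x})) =
        completions (a + card {y \<in> U. y < x}) (b - 1 - card {y \<in> U. y < x})" if "x \<in> U" for x
    proof -
      \<comment> \<open>The upper values smaller than \<open>x\<close> drop below the new maximum
        and join \<open>L\<close>.\<close>
      have "{y \<in> A. y < max m x \<and> y \<noteq> x} = L \<union> {y \<in> U. y < x}"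
        using that less.prems by (auto simp: L_def U_def max_def) (metis linorder_neqE_nat)
      then have 1: "card {y \<in> A. y < max m x \<and> y \<noteq> x} = a + card {y \<in> U. y < x}"
        unfolding a_def using fin A(2) by (simp, subst card_Un_disjoint) auto
      have "U = insert x ({y \<in> U. y < x} \<union> {y \<in> A. max m x < y})"
        using that by (auto simp: U_def max_def)
      moreover have "x \<notin> {y \<in> U. y < x} \<union> {y \<in> A. max m x < y}"
        by auto
      moreover have "finite ({y \<in> U. y < x} \<union> {y \<in> A. max m x < y})"
        using fin less.prems by simp
      ultimately have "b = Suc (card ({y \<in> U. y < x} \<union> {y \<in> A. max m x < y}))"
        unfolding b_def by (metis card_insert_disjoint)
      also have "card ({y \<in> U. y < x} \<union> {y \<in> A. max m x < y}) =
          card {y \<in> U. y < x} + card {y \<in> A. max m x < y}"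
        using fin less.prems by (intro card_Un_disjoint) auto
      finally have 2: "card {y \<in> A. max m x < y} = b - 1 - card {y \<in> U. y < x}"
        by simp
      show ?thesis
        using IH[of x] that unfolding 1 2 by (simp add: U_def)
    qed
    have L: "real (num_admissible (max m x) (A - {x})) = completions (a - 1) b" if "x \<in> L" for x
    proof -
      have "{y \<in> A. y < max m x \<and> y \<noteq> x} = L - {x}" "{y \<in> A. max m x < y} = U"
        using that by (auto simp: L_def U_def)
      then show ?thesis
        using IH[of x] that fin by (simp add: a_def b_def L_def)
    qed
    have "real (num_admissible m A) = (\<Sum>x\<in>A. if m \<le> x \<or> \<not> straddles (A - {x}) x
        then real (num_admissible (max m x) (A - {x})) else 0)"
      unfolding num_admissible_nonempty[OF less.prems(1) False] of_nat_sum
      by (intro sum.cong) simp_all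
    also have "\<dots> = (\<Sum>x\<in>L. if \<not> straddles (A - {x}) x then completions (a - 1) b else 0) +
        (\<Sum>x\<in>U. completions (a + card {y \<in> U. y < x}) (b - 1 - card {y \<in> U. y < x}))"
    proof -
      have "(\<Sum>x\<in>A. f x) = (\<Sum>x\<in>L. f x) + (\<Sum>x\<in>U. f x)" for f :: "nat \<Rightarrow> real"
        using sum.union_disjoint[OF fin A(2)] A(1) by simp
      moreover have "(\<Sum>x\<in>L. if m \<le> x \<or> \<not> straddles (A - {x}) x
          then real (num_admissible (max m x) (A - {x})) else 0) =
          (\<Sum>x\<in>L. if \<not> straddles (A - {x}) x then completions (a - 1) b else 0)"
      proof (rule sum.cong)
        fix x assume "x \<in> L"
        then have "\<not> m \<le> x"
          by (simp add: L_def)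
        then show "(if m \<le> x \<or> \<not> straddles (A - {x}) x
          then real (num_admissible (max m x) (A - {x})) else 0) =
          (if \<not> straddles (A - {x}) x then completions (a - 1) b else 0)"
          unfolding L[OF \<open>x \<in> L\<close>] by simp
      qed simp
      moreover have "(\<Sum>x\<in>U. if m \<le> x \<or> \<not> straddles (A - {x}) x
          then real (num_admissible (max m x) (A - {x})) else 0) =
          (\<Sum>x\<in>U. completions (a + card {y \<in> U. y < x}) (b - 1 - card {y \<in> U. y < x}))"
      proof (rule sum.cong)
        fix x assume "x \<in> U"
        then have "m \<le> x"
          by (simp add: U_def)
        then show "(if m \<le> x \<or> \<not> straddles (A - {x}) x
          then real (num_admissible (max m x) (A - {x})) else 0) =
          completions (a + card {y \<in> U. y < x}) (b - 1 - card {y \<in> U. y < x})"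
          unfolding U[OF \<open>x \<in> U\<close>] by simp
      qed simp
      ultimately show ?thesis
        by simp
    qed
    also have "(\<Sum>x\<in>L. if \<not> straddles (A - {x}) x then completions (a - 1) b else 0) =
        card {x \<in> L. \<not> straddles (A - {x}) x} * completions (a - 1) b"
      using fin by (simp add: sum.If_cases Int_def)
    also have "(\<Sum>x\<in>U. completions (a + card {y \<in> U. y < x}) (b - 1 - card {y \<in> U. y < x})) =
        (\<Sum>i<b. completions (a + i) (b - 1 - i))"
      unfolding b_def by (rule sum_card_below[OF fin(2)])
    finally have eq: "real (num_admissible m A) =
        card {x \<in> L. \<not> straddles (A - {x}) x} * completions (a - 1) b +
        (\<Sum>i<b. completions (a + i) (b - 1 - i))" .
    have "real (num_admissible m A) = completions a b"
    proof (cases b)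
      \<comment> \<open>With \<open>U\<close> empty only the first summand remains, and the next
        entry is the least or the greatest element of \<open>L\<close>; these agree only when
        \<open>a = 1\<close>.\<close>
      case 0
      then have "A = L" "L \<noteq> {}"
        using fin A(1) False by (auto simp: b_def)
      then have "real (num_admissible m A) = (if a = 1 then 1 else 2) * completions (a - 1) 0"
        using eq card_not_straddled[of L] fin 0 by (simp add: a_def)
      moreover have "a > 0"
        using \<open>L \<noteq> {}\<close> fin by (simp add: a_def card_gt_0_iff)
      then obtain c where "a = Suc c"
        by (cases a) auto
      ultimately show ?thesis
        using 0 by (cases c) auto
    next
      case (Suc b')
      then have "U \<noteq> {}"
        by (auto simp: b_def)
      then obtain u where u: "u \<in> A" "m < u"
        by (auto simp: U_def)
      \<comment> \<open>Since \<open>u\<close> lies above all of \<open>L\<close>, only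
        \<open>Min L\<close> escapes straddling. Its contribution
        \<open>completions (a - 1) b\<close> is exactly what \<open>completions_diagonal_sum\<close>
        subtracts.\<close>
      have "card {x \<in> L. \<not> straddles (A - {x}) x} = (if a = 0 then 0 else 1)"
      proof (cases "L = {}")
        case False
        have "{x \<in> L. \<not> straddles (A - {x}) x} = {Min L}"
        proof (intro equalityI subsetI)
          fix x assume "x \<in> {x \<in> L. \<not> straddles (A - {x}) x}"
          then have x: "x \<in> L" "\<not> straddles (A - {x}) x"
            by simp_all
          have "u \<in> A - {x}" "x < u"
            using u x(1) by (auto simp: L_def)
          then have "\<not> y < x" if "y \<in> L" for y
            using x(2) that by (auto simp: straddles_def L_def)
          then have "x = Min L"
            using x(1) fin by (intro Min_eqI[symmetric]) (auto simp: not_less)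
          then show "x \<in> {Min L}"
            by simp
        next
          fix x assume "x \<in> {Min L}"
          then have "x \<in> L" and "\<And>y. y \<in> L \<Longrightarrow> x \<le> y"
            using fin False by auto
          moreover have "\<not> y < x" if "y \<in> A" for y
            using calculation(1) calculation(2)[of y] that by (auto simp: L_def)
          ultimately show "x \<in> {x \<in> L. \<not> straddles (A - {x}) x}"
            by (auto simp: straddles_def)
        qed
        then show ?thesis
          using fin False by (simp add: a_def)
      qed (simp add: a_def)
      then show ?thesis
        using eq completions_diagonal_sum[where a = a and b = b'] unfolding Suc by simp
    qed
    then show ?thesis
      by (simp add: a_def b_def L_def U_def)
  qed
qed

subsection \<open>The central binomial series\<close>

definition central :: "real fps" where
  "central = Abs_fps (\<lambda>n. real ((2 * n) choose n))"

text \<open>This is the coefficient form of the differential equation in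
  \<open>central_deriv\<close>. The two middle entries of row \<open>Suc (2 * n)\<close> agree,
  which links two absorption identities.\<close>

lemma Suc_mult_central_binomial:
  "Suc n * ((2 * Suc n) choose Suc n) = 2 * (2 * n + 1) * ((2 * n) choose n)"
proof -
  have 1: "Suc n * (Suc (Suc (2 * n)) choose Suc n) = Suc (Suc (2 * n)) * (Suc (2 * n) choose n)"
    by (rule Suc_times_binomial)
  have "Suc (2 * n) choose n = Suc (2 * n) choose Suc n"
    using binomial_symmetric[of n "Suc (2 * n)"] by simp
  moreover have "Suc n * (Suc (2 * n) choose Suc n) = Suc (2 * n) * ((2 * n) choose n)"
    by (rule Suc_times_binomial)
  ultimately show ?thesis
    using 1 by (simp del: binomial_Suc_Suc)
qed

lemma central_deriv: "(1 - 4 * fps_X) * fps_deriv central = 2 * central"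
proof (rule fps_ext)
  fix n
  have "real (Suc n * ((2 * Suc n) choose Suc n)) = real (2 * (2 * n + 1) * ((2 * n) choose n))"
    by (simp only: Suc_mult_central_binomial)
  then show "((1 - 4 * fps_X) * fps_deriv central) $ n = (2 * central) $ n"
    by (cases n) (simp_all add: central_def algebra_simps numeral_fps_const fps_mult_left_const_nth)
qed

text \<open>By the differential equation the left side has derivative zero, so it equals its
  constant coefficient 1.\<close>

lemma central_square: "(1 - 4 * fps_X) * central\<^sup>2 = 1"
proof -
  have "fps_deriv ((1 - 4 * fps_X) * central\<^sup>2) =
      2 * central * ((1 - 4 * fps_X) * fps_deriv central) - 4 * central\<^sup>2"
    by (simp add: fps_deriv_power algebra_simps power2_eq_square)
  also have "\<dots> = 0"
    unfolding central_deriv by (simp add: power2_eq_square)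
  finally have "(1 - 4 * fps_X) * central\<^sup>2 = fps_const (((1 - 4 * fps_X) * central\<^sup>2) $ 0)"
    by (rule fps_deriv_eq_0_iff[THEN iffD1])
  then show ?thesis
    by (simp add: central_def power2_eq_square)
qed

text \<open>The product squares to 1, hence is 1 or -1; the constant coefficient decides the
  sign.\<close>

lemma radical_times_central: "fps_radical root 2 (1 - 4 * fps_X) * central = 1"
proof -
  let ?s = "fps_radical root 2 (1 - 4 * fps_X) :: real fps"
  have "?s\<^sup>2 = 1 - 4 * fps_X"
    using power_radical[of "1 - 4 * fps_X :: real fps" root 1] by (simp add: numeral_2_eq_2)
  then have "(?s * central)\<^sup>2 = 1"
    by (simp add: power_mult_distrib central_square)
  then have "?s * central = 1 \<or> ?s * central = -1"
    by (rule power2_eq_1_iff[THEN iffD1])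
  moreover have "(?s * central) $ 0 = 1"
    by (simp add: central_def)
  ultimately show ?thesis
    by (auto simp: fps_eq_iff)
qed

section \<open>Passing from one variable to two\<close>

lemma of_series_x_mult: "of_series_x (f * g) = of_series_x f * of_series_x g"
proof -
  have "fps_const (sum h A) = (\<Sum>i\<in>A. fps_const (h i))" for h :: "nat \<Rightarrow> real" and A
    by (induction A rule: infinite_finite_induct) (simp_all flip: fps_const_add)
  then show ?thesis
    by (intro fps_ext[of "of_series_x (f * g)"]) (simp add: of_series_x_def fps_mult_nth)
qed

lemma of_series_x_1: "of_series_x 1 = 1"
  by (rule fps_ext) (simp add: of_series_x_def)

text \<open>
  The library's cancellation rules for division of power series need field coefficients; here the
  coefficients are themselves power series, and \<open>g\<close> is a unit because \<open>g $ 0\<close> is one.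
\<close>

lemma fps_fps_divide_eqI:
  fixes f g h :: "'a::field fps fps"
  assumes "h * g = f" and "g $ 0 $ 0 \<noteq> 0"
  shows "h = f / g"
proof -
  have "g $ 0 \<noteq> 0" using assms(2) by auto
  then have "f / g = f * inverse g"
    by (rule fps_divide_unit)
  also have "\<dots> = h * (g * inverse g)"
    by (simp add: assms(1)[symmetric] mult.assoc)
  also have "g * inverse g = 1"
    unfolding fps_inverse_def[of g]
    by (rule fps_right_inverse) (rule inverse_mult_eq_1'[OF assms(2)])
  finally show ?thesis by simp
qed

subsection \<open>The functional equation\<close>

text \<open>Once \<open>k\<close> is read, \<open>k - 1\<close> smaller and \<open>n - k\<close>
  larger values remain, and avoidance by the whole word is \<open>admissible k\<close> for the
  rest.\<close>

lemma card_avoiders_hd: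
  assumes "k \<in> {1..n}"
  shows "real (card {\<sigma> \<in> avoiders n T1. hd \<sigma> = k}) = completions (k - 1) (n - k)"
proof -
  have ne: "{1..n} \<noteq> {}"
    using assms by auto
  have "avoiders n T1 = {\<sigma> \<in> permutations_of_set {1..n}. \<not> has_pattern \<sigma>}"
    unfolding avoiders_def using avoids_T1_iff permutations_of_setD(2) by blast
  then have "{\<sigma> \<in> avoiders n T1. hd \<sigma> = k} =
      (#) k ` {xs \<in> permutations_of_set ({1..n} - {k}). admissible k xs}"
    using assms unfolding permutations_of_set_nonempty[OF ne]
    by (auto simp: admissible_def has_pattern_Cons)
  then have "card {\<sigma> \<in> avoiders n T1. hd \<sigma> = k} = num_admissible k ({1..n} - {k})"
    by (simp add: card_image num_admissible_def)
  moreover have "{x \<in> {1..n} - {k}. x < k} = {1..<k}" "{x \<in> {1..n} - {k}. k < x} = {k<..n}"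
    using assms by auto
  ultimately show ?thesis
    using num_admissible_eq_completions[of "{1..n} - {k}" k] by simp
qed

lemma H_nth_nth:
  "H $ n $ k = (if 1 \<le> k \<and> k \<le> n then completions (k - 1) (n - k) else 0)"
proof (cases "n = 0")
  case False
  have fin: "finite (avoiders n T1)"
    by (simp add: avoiders_def)
  have "H $ n $ k = (\<Sum>\<sigma>\<in>avoiders n T1. if k = hd \<sigma> then 1 else 0)"
    using False by (simp add: H_def fps_sum_nth fps_X_power_nth)
  also have "\<dots> = real (card {\<sigma> \<in> avoiders n T1. hd \<sigma> = k})"
    using fin by (simp add: sum.If_cases Int_def eq_commute)
  also have "\<dots> = (if 1 \<le> k \<and> k \<le> n then completions (k - 1) (n - k) else 0)"
  proof (cases "k \<in> {1..n}")
    case True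
    then show ?thesis
      using card_avoiders_hd by simp
  next
    case k: False
    have "hd \<sigma> \<in> {1..n}" if "\<sigma> \<in> avoiders n T1" for \<sigma>
    proof -
      have "set \<sigma> = {1..n}"
        using that by (auto simp: avoiders_def dest: permutations_of_setD)
      moreover from this have "\<sigma> \<noteq> []"
        using False by auto
      ultimately show ?thesis
        using hd_in_set by blast
    qed
    then have "{\<sigma> \<in> avoiders n T1. hd \<sigma> = k} = {}"
      using k by auto
    then have "card {\<sigma> \<in> avoiders n T1. hd \<sigma> = k} = 0"
      by (simp only: card.empty)
    then show ?thesis
      using k by auto
  qed
  finally show ?thesis .
qed (simp add: H_def)

section \<open>Multiplying \<open>H\<close> by the kernel 1 - y + x y^2\<close>

definition geometric_2xy :: "real fps fps" where
  "geometric_2xy = Abs_fps (\<lambda>n. fps_const (2 ^ n) * fps_X ^ n)"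

lemma geometric_2xy: "(1 - 2 * var_x * var_y) * geometric_2xy = 1"
proof (rule fps_ext)
  fix n
  have "(1 - 2 * var_x * var_y) * geometric_2xy = geometric_2xy - var_x * (2 * var_y * geometric_2xy)"
    by (simp add: algebra_simps)
  also have "2 * var_y = fps_const (fps_const 2 * fps_X)"
    by (simp add: var_y_def numeral_fps_const)
  finally have eq: "(1 - 2 * var_x * var_y) * geometric_2xy =
      geometric_2xy - fps_X * (fps_const (fps_const 2 * fps_X) * geometric_2xy)"
    unfolding var_x_def .
  have "fps_const (2 ^ Suc m) * fps_X ^ Suc m =
      fps_const 2 * fps_X * (fps_const (2 ^ m) * fps_X ^ m :: real fps)" for m
    by (simp add: mult_ac flip: fps_const_mult)
  then show "((1 - 2 * var_x * var_y) * geometric_2xy) $ n = 1 $ n"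
    unfolding eq by (cases n) (simp_all add: geometric_2xy_def)
qed

text \<open>The left side is the coefficient of x^(m+3) y^(j+2) in the kernel times
  \<open>H\<close>. For \<open>j\<close> at most \<open>m\<close> the recurrence for
  \<open>completions\<close> makes it vanish, with \<open>j = 0\<close> as boundary case. The
  recurrence stops at second argument 1, which leaves powers of 2 at \<open>j = m + 1\<close> and
  \<open>j = m + 2\<close>.\<close>

lemma kernel_coefficient:
  "H $ (m + 3) $ (j + 2) - H $ (m + 3) $ (j + 1) + H $ (m + 2) $ j =
     (if j = m + 1 then 2 ^ m else if j = m + 2 then - (2 ^ m) else 0)"
proof (cases "j = 0 \<or> j > m")
  case True
  then consider "j = 0" | "j = m + 1" | "j = m + 2" | "j > m + 2"
    by linarith
  then show ?thesis
  proof cases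
    case 1
    then show ?thesis
      using completions_0_Suc_Suc[of m] by (simp add: H_nth_nth numeral_eq_Suc del: completions.simps)
  qed (simp_all add: H_nth_nth)
next
  case False
  then obtain i b where j: "j = Suc i" and m: "m = j + b"
    by (metis gr0_implies_Suc le_Suc_ex neq0_conv not_le)
  show ?thesis
    using completions_Suc_Suc[of i b] unfolding m j
    by (simp add: H_nth_nth numeral_eq_Suc del: completions.simps)
qed

text \<open>From x^3 on, the coefficient of y counts the permutations starting with 1 and gives the
  central binomials, while higher powers of y leave only the values in
  \<open>kernel_coefficient\<close>, which form the geometric series. The nested factors
  \<open>var_x\<close> let coefficients be read off one shift at a time.\<close>

lemma kernel_equation:
  "(1 - var_y + var_x * var_y\<^sup>2) * H =
     var_x * (var_y * (1 - var_y)) + var_x * (var_x * (var_y * of_series_x central)) +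
     var_x * (var_x * (var_x * ((1 - var_y) * var_y ^ 3 * geometric_2xy)))" (is "?lhs = ?rhs")
proof (rule fps_ext)
  fix n
  have "?lhs = fps_const (1 - fps_X) * H + fps_X * (fps_const (fps_X\<^sup>2) * H)"
    by (simp add: var_x_def var_y_def algebra_simps fps_const_power flip: fps_const_sub)
  then have lhs: "?lhs $ n = (1 - fps_X) * H $ n + (if n = 0 then 0 else fps_X\<^sup>2 * H $ (n - 1))"
    by simp
  have rhs: "?rhs = fps_X * fps_const (fps_X * (1 - fps_X)) +
      fps_X * (fps_X * (fps_const fps_X * of_series_x central)) +
      fps_X * (fps_X * (fps_X * (fps_const ((1 - fps_X) * fps_X ^ 3) * geometric_2xy)))"
    by (simp add: var_x_def var_y_def fps_const_power flip: fps_const_sub fps_const_mult)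
  \<comment> \<open>The last summand starts at x^3, and \<open>kernel_coefficient\<close> covers
    exactly these exponents; the smaller ones are checked directly.\<close>
  consider "n = 0" | "n = 1" | "n = 2" | m where "n = m + 3"
    by (metis One_nat_def Suc_1 add.commute add_Suc_right less_2_cases_iff not_less_eq
        numeral_3_eq_3 le_Suc_ex linorder_neqE_nat not_less nat_less_le Suc_leI)
  then show "?lhs $ n = ?rhs $ n"
  proof cases
    case 1
    then show ?thesis
      unfolding lhs rhs by (simp add: H_def)
  next
    case 2
    have "H $ 1 = fps_X"
      by (rule fps_ext) (simp add: H_nth_nth fps_X_def)
    moreover have "H $ 0 = 0"
      by (simp add: H_def)
    ultimately show ?thesis
      using 2 unfolding lhs rhs by (simp add: algebra_simps)
  next
    case 3
    have "H $ 1 = fps_X"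
      by (rule fps_ext) (simp add: H_nth_nth fps_X_def)
    moreover have "H $ 2 = fps_X + fps_X\<^sup>2"
    proof (rule fps_ext)
      fix k :: nat
      consider "k = 0" | "k = 1" | "k = 2" | "k > 2"
        by linarith
      then show "H $ 2 $ k = (fps_X + fps_X\<^sup>2) $ k"
        by cases (simp_all add: H_nth_nth fps_X_nth fps_X_power_nth)
    qed
    ultimately show ?thesis
      using 3 unfolding lhs rhs
      by (simp add: algebra_simps power2_eq_square of_series_x_def central_def)
  next
    case (4 m)
    have "?rhs $ n = fps_X * fps_const (real (2 * (m + 1) choose (m + 1))) +
        (1 - fps_X) * fps_X ^ 3 * (fps_const (2 ^ m) * fps_X ^ m)"
      unfolding rhs 4 by (simp add: numeral_3_eq_3 of_series_x_def central_def geometric_2xy_def)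
    also have "\<dots> = fps_X * fps_const (real (2 * (m + 1) choose (m + 1))) +
        fps_const (2 ^ m) * (fps_X ^ (m + 3) - fps_X ^ (m + 4))"
      by (simp add: algebra_simps power_add numeral_eq_Suc)
    finally have rhs': "?rhs $ n = \<dots>" .
    have lhs': "?lhs $ n = H $ (m + 3) - fps_X * H $ (m + 3) + fps_X * (fps_X * H $ (m + 2))"
      unfolding lhs unfolding 4 by (simp add: algebra_simps power2_eq_square)
    show ?thesis
      unfolding lhs' rhs'
    proof (rule fps_ext)
      fix k :: nat
      consider "k = 0" | "k = 1" | j where "k = j + 2"
        by (metis One_nat_def Suc_1 add.commute le_Suc_ex less_2_cases_iff not_less)
      then show "(H $ (m + 3) - fps_X * H $ (m + 3) + fps_X * (fps_X * H $ (m + 2))) $ k =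
        (fps_X * fps_const (real (2 * (m + 1) choose (m + 1))) +
          fps_const (2 ^ m) * (fps_X ^ (m + 3) - fps_X ^ (m + 4))) $ k"
      proof cases
        case 2
        have "completions 0 (Suc (Suc m)) = real (2 * (m + 1) choose (m + 1))"
          using completions_0_Suc[of "Suc m"] by simp
        with 2 show ?thesis
          by (simp add: H_nth_nth fps_X_power_nth numeral_eq_Suc del: completions.simps binomial_Suc_Suc)
      next
        case (3 j)
        then show ?thesis
          using kernel_coefficient[of m j] by (simp add: fps_X_power_nth)
      qed (simp add: H_nth_nth)
    qed
  qed
qed

theorem theorem11:
  shows "let x = var_x; y = var_y; s = sqrt_1_minus_4x in
    H = (x * y * ((x * y - 1)\<^sup>2 * (1 - y) * s + x * (1 - 2 * x * y))) /
        ((1 - y + x * y\<^sup>2) * (1 - 2 * x * y) * s)"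
  unfolding Let_def
proof (rule fps_fps_divide_eqI)
  let ?x = var_x and ?y = var_y and ?s = sqrt_1_minus_4x
  let ?R = "of_series_x central" and ?P = geometric_2xy
  have sR: "?s * ?R = 1"
    unfolding sqrt_1_minus_4x_def
    by (simp add: radical_times_central of_series_x_1 flip: of_series_x_mult)
  \<comment> \<open>Multiplying the kernel equation by 1 - 2xy and by the square root clears the
    inverse series \<open>?P\<close> and \<open>?R\<close>.\<close>
  have "H * ((1 - ?y + ?x * ?y\<^sup>2) * (1 - 2 * ?x * ?y) * ?s) =
      ((1 - ?y + ?x * ?y\<^sup>2) * H) * ((1 - 2 * ?x * ?y) * ?s)"
    by (simp only: mult_ac)
  also have "\<dots> = ?x * ?y * (1 - ?y) * (1 - 2 * ?x * ?y) * ?s +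
      (?s * ?R) * (?x\<^sup>2 * ?y * (1 - 2 * ?x * ?y)) +
      ((1 - 2 * ?x * ?y) * ?P) * ((1 - ?y) * ?x ^ 3 * ?y ^ 3 * ?s)"
    unfolding kernel_equation by (simp add: algebra_simps power2_eq_square power3_eq_cube)
  \<comment> \<open>The first and third summands combine because (1 - 2xy) + (xy)^2 = (xy -
    1)^2.\<close>
  also have "\<dots> = ?x * ?y * ((?x * ?y - 1)\<^sup>2 * (1 - ?y) * ?s + ?x * (1 - 2 * ?x * ?y))"
    unfolding sR geometric_2xy by (simp add: algebra_simps power2_eq_square power3_eq_cube)
  finally show "H * ((1 - ?y + ?x * ?y\<^sup>2) * (1 - 2 * ?x * ?y) * ?s) =
      ?x * ?y * ((?x * ?y - 1)\<^sup>2 * (1 - ?y) * ?s + ?x * (1 - 2 * ?x * ?y))" .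
  show "((1 - ?y + ?x * ?y\<^sup>2) * (1 - 2 * ?x * ?y) * ?s) $ 0 $ 0 \<noteq> 0"
    by (simp add: var_x_def var_y_def sqrt_1_minus_4x_def of_series_x_def)
qed

end
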